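(* Let $X$ be a real random variable with finite law $x_1<\cdots<x_n$, $p_i=\mathbb P(X=x_i)>0$, $\sum_{i=1}^n p_i=1$, $n\ge 2$, with $P_i,W_i,L_i,R_i$ as defined in the context. Let $\mathcal W$ be the polygonal (piecewise linear) interpolation through the points $(P_i,W_i)$, $0\le i\le n$. Its slope on $[P_{i-1},P_i]$ is $$\frac{W_i-W_{i-1}}{p_i}=L_i^2-R_i^2 .$$ Hence $\mathcal W$ is convex if and only if the sequence $D_i:=R_i^2-L_i^2$ $(1\le i\le n)$ is nonincreasing in $i$. If $(D_i)$ is nonincreasing, the minimizing cut indices (indices $i$ minimizing $W_i$) form one consecutive block. If $(D_i)$ is strictly decreasing, there is exactly one minimizing vertex, except that if $D_i=0$ for some $i$, then the minimizing vertices are exactly the two endpoints $i-1$ and $i$ of one flat edge.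
   Context: Put $P_i:=\sum_{j\le i}p_j$, $P_0:=0$, and $T_i:=\sum_{j\ge i}p_j=1-P_{i-1}$. For $1\le i<n$ the optimized squared risk at the cut after $x_i$ is $$W_i:=\min_{a,b\in\mathbb R}\Big\{\sum_{j\le i}p_j(x_j-a)^2+\sum_{j>i}p_j(x_j-b)^2\Big\},$$ and $W_0=W_n:=\operatorname{Var}(X)$. For $1\le i<n$ set $A_i:=\sum_{j>i}p_j(x_j-x_i)$ and $R_i:=A_i/\sqrt{T_iT_{i+1}}$; for $1<i\le n$ set $C_i:=\sum_{j<i}p_j(x_i-x_j)$ and $L_i:=C_i/\sqrt{P_{i-1}P_i}$; and $L_1:=0$, $R_n:=0$. *)

theory Defs
  imports "HOL-Probability.Probability"
begin

text \<open>Atoms \<open>x 1 < \<dots> < x n\<close> and their masses \<open>p 1, \<dots>, p n\<close> are functions on \<open>nat\<close>;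
  only the indices \<open>1..n\<close> matter.\<close>

definition P_cum :: "(nat \<Rightarrow> real) \<Rightarrow> nat \<Rightarrow> real" where
  "P_cum p i = (\<Sum>j=1..i. p j)"

definition T_tail :: "nat \<Rightarrow> (nat \<Rightarrow> real) \<Rightarrow> nat \<Rightarrow> real" where
  "T_tail n p i = (\<Sum>j=i..n. p j)"

definition cut_loss :: "nat \<Rightarrow> (nat \<Rightarrow> real) \<Rightarrow> (nat \<Rightarrow> real) \<Rightarrow> nat \<Rightarrow> real \<Rightarrow> real \<Rightarrow> real" where
  "cut_loss n x p i a b =
     (\<Sum>j=1..i. p j * (x j - a)\<^sup>2) + (\<Sum>j=i+1..n. p j * (x j - b)\<^sup>2)"

text \<open>\<open>LEAST\<close> over the values of the loss denotes an attained minimum, not merely an infimum.\<close>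

definition W_risk ::
  "'a measure \<Rightarrow> ('a \<Rightarrow> real) \<Rightarrow> nat \<Rightarrow> (nat \<Rightarrow> real) \<Rightarrow> (nat \<Rightarrow> real) \<Rightarrow> nat \<Rightarrow> real" where
  "W_risk M X n x p i =
     (if i = 0 \<or> i = n then prob_space.variance M X
      else (LEAST v. \<exists>a b. v = cut_loss n x p i a b))"

definition A_up :: "nat \<Rightarrow> (nat \<Rightarrow> real) \<Rightarrow> (nat \<Rightarrow> real) \<Rightarrow> nat \<Rightarrow> real" where
  "A_up n x p i = (\<Sum>j=i+1..n. p j * (x j - x i))"

definition R_coef :: "nat \<Rightarrow> (nat \<Rightarrow> real) \<Rightarrow> (nat \<Rightarrow> real) \<Rightarrow> nat \<Rightarrow> real" where
  "R_coef n x p i =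
     (if i = n then 0 else A_up n x p i / sqrt (T_tail n p i * T_tail n p (i + 1)))"

definition C_down :: "(nat \<Rightarrow> real) \<Rightarrow> (nat \<Rightarrow> real) \<Rightarrow> nat \<Rightarrow> real" where
  "C_down x p i = (\<Sum>j\<in>{1..<i}. p j * (x i - x j))"

definition L_coef :: "(nat \<Rightarrow> real) \<Rightarrow> (nat \<Rightarrow> real) \<Rightarrow> nat \<Rightarrow> real" where
  "L_coef x p i =
     (if i = 1 then 0 else C_down x p i / sqrt (P_cum p (i - 1) * P_cum p i))"

definition D_seq :: "nat \<Rightarrow> (nat \<Rightarrow> real) \<Rightarrow> (nat \<Rightarrow> real) \<Rightarrow> nat \<Rightarrow> real" where
  "D_seq n x p i = (R_coef n x p i)\<^sup>2 - (L_coef x p i)\<^sup>2"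

text \<open>Piecewise linear interpolation through the points \<open>(u i, v i)\<close> with nodes
  \<open>u 0 < \<dots> < u n\<close>. It is meaningful on \<open>{u 0..u n}\<close> only; at an interior node the least
  admissible edge is the one ending there.\<close>

definition polygonal :: "(nat \<Rightarrow> real) \<Rightarrow> (nat \<Rightarrow> real) \<Rightarrow> real \<Rightarrow> real" where
  "polygonal u v t =
     (let i = (LEAST i. 1 \<le> i \<and> t \<le> u i)
      in v (i - 1) + (v i - v (i - 1)) / (u i - u (i - 1)) * (t - u (i - 1)))"

lemma polygonal_edge:
  assumes u: "strict_mono_on {0..n} u" and i: "i \<in> {1..n}" and t: "t \<in> {u (i - 1)..u i}"
  shows "polygonal u v t = v (i - 1) + (v i - v (i - 1)) / (u i - u (i - 1)) * (t - u (i - 1))"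
proof -
  define k where "k = (LEAST i. 1 \<le> i \<and> t \<le> u i)"
  have k: "1 \<le> k \<and> t \<le> u k"
    unfolding k_def by (rule LeastI[of _ i]) (use i t in auto)
  have ki: "k \<le> i"
    unfolding k_def by (rule Least_le) (use i t in auto)
  have less: "u a < u b" if "a < b" "b \<le> n" for a b
    using strict_mono_onD[OF u, of a b] that by auto
  show ?thesis
  proof (cases "k = i")
    case True
    then show ?thesis by (simp add: polygonal_def k_def Let_def)
  next
    case False
    then have "k \<le> i - 1" using ki by auto
    moreover have "i - 1 \<le> n" using i by auto
    then have "\<not> k < i - 1"
      using less[of k "i - 1"] k t by auto
    ultimately have ke: "k = i - 1" by auto
    then have te: "t = u k" using k t by auto
    have "u (k - 1) < u k" using less[of "k - 1" k] k ki i by auto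
    moreover have "polygonal u v t = v (k - 1) + (v k - v (k - 1)) / (u k - u (k - 1)) * (t - u (k - 1))"
      unfolding polygonal_def k_def[symmetric] Let_def by simp
    ultimately have "polygonal u v t = v k" using te by simp
    then show ?thesis using ke te by simp
  qed
qed

lemma polygonal_vertex:
  assumes "strict_mono_on {0..n} u" and "1 \<le> n" and "i \<le> n"
  shows "polygonal u v (u i) = v i"
proof (cases "i = 0")
  case True
  have "u 0 < u 1" using strict_mono_onD[OF assms(1), of 0 1] assms(2) by auto
  then show ?thesis using polygonal_edge[OF assms(1), of 1 "u 0" v] assms(2) True by auto
next
  case False
  have "u (i - 1) < u i" using strict_mono_onD[OF assms(1), of "i - 1" i] False assms(3) by auto
  then show ?thesis using polygonal_edge[OF assms(1), of i "u i" v] False assms(3) by auto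
qed

definition W_poly ::
  "'a measure \<Rightarrow> ('a \<Rightarrow> real) \<Rightarrow> nat \<Rightarrow> (nat \<Rightarrow> real) \<Rightarrow> (nat \<Rightarrow> real) \<Rightarrow> real \<Rightarrow> real" where
  "W_poly M X n x p = polygonal (P_cum p) (W_risk M X n x p)"

text \<open>Cuts separate \<open>x 1, \<dots>, x i\<close> from \<open>x (i + 1), \<dots>, x n\<close> with both parts nonempty; the
  vertices of the polygon include in addition the two ends \<open>0\<close> and \<open>n\<close>.\<close>

definition minimizing_cuts ::
  "'a measure \<Rightarrow> ('a \<Rightarrow> real) \<Rightarrow> nat \<Rightarrow> (nat \<Rightarrow> real) \<Rightarrow> (nat \<Rightarrow> real) \<Rightarrow> nat set" where
  "minimizing_cuts M X n x p = {i. is_arg_min (W_risk M X n x p) (\<lambda>i. i \<in> {1..<n}) i}"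

definition minimizing_vertices ::
  "'a measure \<Rightarrow> ('a \<Rightarrow> real) \<Rightarrow> nat \<Rightarrow> (nat \<Rightarrow> real) \<Rightarrow> (nat \<Rightarrow> real) \<Rightarrow> nat set" where
  "minimizing_vertices M X n x p = {i. is_arg_min (W_risk M X n x p) (\<lambda>i. i \<in> {0..n}) i}"

definition consecutive_block :: "nat set \<Rightarrow> bool" where
  "consecutive_block S \<longleftrightarrow> (\<exists>a b. a \<le> b \<and> S = {a..b})"

end

(* Split at the cut, the optimal risk is the sum of two within-block weighted sums of squares.
   Moving the atom x i from the right block to the left one raises the left sum by p i * L_i^2
   and lowers the right one by p i * R_i^2, which gives the edge slopes. The rest is the
   geometry of a polygon whose slopes increase: it lies above the line through each edge. *)

theory Submission
  imports Defs
begin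

section \<open>Weighted sums of squares about the mean\<close>

definition weighted_sse :: "('b \<Rightarrow> real) \<Rightarrow> ('b \<Rightarrow> real) \<Rightarrow> 'b set \<Rightarrow> real" where
  "weighted_sse p x S = (\<Sum>j\<in>S. p j * (x j)\<^sup>2) - (\<Sum>j\<in>S. p j * x j)\<^sup>2 / (\<Sum>j\<in>S. p j)"

text \<open>Completing the square in \<open>a\<close>. For positive total weight this exhibits
  \<open>weighted_sse p x S\<close> as the minimum over \<open>a\<close> of the left side, attained
  at the weighted mean of the block.\<close>

lemma weighted_sum_squares_eq:
  assumes "(\<Sum>j\<in>S. p j) \<noteq> (0::real)"
  shows "(\<Sum>j\<in>S. p j * (x j - a)\<^sup>2) =
    weighted_sse p x S + (\<Sum>j\<in>S. p j) * (a - (\<Sum>j\<in>S. p j * x j) / (\<Sum>j\<in>S. p j))\<^sup>2"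
proof -
  have "(\<Sum>j\<in>S. p j * (x j - a)\<^sup>2) =
      (\<Sum>j\<in>S. p j * (x j)\<^sup>2) - 2 * a * (\<Sum>j\<in>S. p j * x j) + a\<^sup>2 * (\<Sum>j\<in>S. p j)"
    by (simp add: power2_eq_square algebra_simps sum.distrib sum_subtractf sum_distrib_left)
  moreover have "P * (a - m / P)\<^sup>2 - m\<^sup>2 / P = a\<^sup>2 * P - 2 * a * m" if "P \<noteq> 0" for P m :: real
    using that by (simp add: power2_eq_square field_simps)
  note this[OF assms, of "\<Sum>j\<in>S. p j * x j"]
  ultimately show ?thesis by (simp add: weighted_sse_def)
qed

text \<open>Updating a variance by one atom: a block of mass P and mean m/P gains q P (x k - m/P)^2
  / (q + P), with q the mass of the new atom. Clearing m/P turns the difference into the sum over j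
  of \<open>p j * (x k - x j)\<close>, the quantity behind both \<open>C_down\<close> and
  \<open>A_up\<close>.\<close>

lemma weighted_sse_insert:
  assumes S: "finite S" "k \<notin> S" and p: "\<And>j. j \<in> insert k S \<Longrightarrow> p j > 0"
  shows "weighted_sse p x (insert k S) = weighted_sse p x S +
    p k * ((\<Sum>j\<in>S. p j * (x k - x j))\<^sup>2 / ((\<Sum>j\<in>S. p j) * (\<Sum>j\<in>insert k S. p j)))"
\<comment> \<open>For empty \<open>S\<close> the quotient is 0/0 = 0, and a single atom has no
  spread. This matches the conventions L_1 = 0 and R_n = 0.\<close>
proof (cases "S = {}")
  case True
  have "p k > 0" using p by simp
  then show ?thesis by (simp add: True weighted_sse_def power2_eq_square)
next
  case False
  define P where "P = (\<Sum>j\<in>S. p j)"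
  define m where "m = (\<Sum>j\<in>S. p j * x j)"
  have P: "P > 0" unfolding P_def by (rule sum_pos) (use False S p in auto)
  have q: "p k > 0" using p by simp
  have "(\<Sum>j\<in>S. p j * (x k - x j)) = x k * P - m"
    by (simp add: P_def m_def algebra_simps sum_subtractf sum_distrib_left)
  moreover have "p k * (x k)\<^sup>2 - (p k * x k + m)\<^sup>2 / (p k + P) =
      - (m\<^sup>2 / P) + p k * (x k * P - m)\<^sup>2 / (P * (p k + P))"
  proof -
    have "p k + P \<noteq> 0" "P \<noteq> 0" using P q by auto
    then show ?thesis by (simp add: divide_simps) algebra
  qed
  ultimately show ?thesis
    using S by (simp add: weighted_sse_def flip: P_def m_def)
qed

section \<open>Expectations under a finite law\<close>

lemma (in prob_space) expectation_finite_law: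
  fixes X :: "'a \<Rightarrow> real"
  assumes X: "random_variable borel X" and A: "finite A"
    and one: "(\<Sum>a\<in>A. prob {\<omega> \<in> space M. X \<omega> = a}) = 1"
    and f: "f \<in> borel_measurable borel"
  shows "expectation (\<lambda>\<omega>. f (X \<omega>)) = (\<Sum>a\<in>A. prob {\<omega> \<in> space M. X \<omega> = a} * f a)"
proof -
  let ?E = "\<lambda>a. {\<omega> \<in> space M. X \<omega> = a}"
  have E[measurable]: "?E a \<in> sets M" for a using X by measurable
  \<comment> \<open>The level sets are disjoint and their masses sum to 1, so \<open>X\<close> takes
    values in \<open>A\<close> almost surely and \<open>f (X \<omega>)\<close> is almost everywhere
    a finite combination of indicators.\<close>
  have "prob (\<Union>a\<in>A. ?E a) = 1"
    by (subst finite_measure_finite_Union) (use A one in \<open>auto simp: disjoint_family_on_def\<close>)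
  then have "AE \<omega> in M. \<omega> \<in> (\<Union>a\<in>A. ?E a)"
    using A by (subst AE_in_set_eq_1) auto
  then have "AE \<omega> in M. f (X \<omega>) = (\<Sum>a\<in>A. indicator (?E a) \<omega> * f a)"
  proof eventually_elim
    case (elim \<omega>)
    then have "(\<Sum>a\<in>A. indicator (?E a) \<omega> * f a) = (\<Sum>a\<in>A. if a = X \<omega> then f a else 0)"
      by (intro sum.cong) (auto simp: indicator_def)
    then show ?case using A elim by auto
  qed
  then have "expectation (\<lambda>\<omega>. f (X \<omega>)) = expectation (\<lambda>\<omega>. \<Sum>a\<in>A. indicator (?E a) \<omega> * f a)"
  proof (rule integral_cong_AE[rotated 2])
    show "random_variable borel (\<lambda>\<omega>. f (X \<omega>))" using X f by (rule measurable_compose)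
  qed measurable
  also have "\<dots> = (\<Sum>a\<in>A. prob (?E a) * f a)"
    by (subst Bochner_Integration.integral_sum) (auto simp: emeasure_eq_measure)
  finally show ?thesis .
qed

section \<open>Consecutive blocks and polygons with given edge slopes\<close>

lemma consecutive_blockI:
  assumes "finite S" "S \<noteq> {}" and "\<And>a b c. \<lbrakk>a \<in> S; c \<in> S; a < b; b < c\<rbrakk> \<Longrightarrow> b \<in> S"
  shows "consecutive_block S"
proof -
  have MS: "Min S \<in> S" "Max S \<in> S" using assms(1,2) by auto
  have "b \<in> S" if "b \<in> {Min S..Max S}" for b
    using that assms(3)[of "Min S" "Max S" b] MS by (cases "b = Min S \<or> b = Max S") auto
  moreover have "S \<subseteq> {Min S..Max S}" using Min_le[OF assms(1)] Max_ge[OF assms(1)] by auto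
  ultimately have "S = {Min S..Max S}" by blast
  moreover have "Min S \<le> Max S" by (rule Min_le[OF assms(1) MS(2)])
  ultimately show ?thesis unfolding consecutive_block_def by blast
qed

text \<open>The slopes \<open>s\<close> are separate data tied to the heights \<open>v\<close> in
  product form, so that a closed formula for the slopes can be plugged in directly.\<close>

locale polygon =
  fixes n :: nat and u v s :: "nat \<Rightarrow> real"
  assumes nodes: "strict_mono_on {0..n} u" and n_pos: "1 \<le> n"
    and edge: "i \<in> {1..n} \<Longrightarrow> v i = v (i - 1) + s i * (u i - u (i - 1))"
begin

lemma node_less: "a < b \<Longrightarrow> b \<le> n \<Longrightarrow> u a < u b"
  using strict_mono_onD[OF nodes, of a b] by auto

lemma node_le: "a \<le> b \<Longrightarrow> b \<le> n \<Longrightarrow> u a \<le> u b"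
  using node_less[of a b] by (cases "a = b") auto

lemma polygonal_on_edge:
  assumes i: "i \<in> {1..n}" and t: "t \<in> {u (i - 1)..u i}"
  shows "polygonal u v t = v (i - 1) + s i * (t - u (i - 1))"
proof -
  have "u (i - 1) < u i" using node_less[of "i - 1" i] i by auto
  then have "(v i - v (i - 1)) / (u i - u (i - 1)) = s i" using edge[OF i] by simp
  then show ?thesis using polygonal_edge[OF nodes i t, of v] by simp
qed

lemma edge_cover:
  assumes t: "t \<in> {u 0..u n}"
  obtains i where "i \<in> {1..n}" "t \<in> {u (i - 1)..u i}"
proof (cases "t \<le> u 1")
  case True
  then show ?thesis using that[of 1] t n_pos by auto
next
  case False
  define k where "k = (LEAST i. 1 \<le> i \<and> t \<le> u i)"
  have k: "1 \<le> k \<and> t \<le> u k"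
    unfolding k_def by (rule LeastI[of _ n]) (use t n_pos in auto)
  have "k \<le> n" unfolding k_def by (rule Least_le) (use t n_pos in auto)
  moreover have "k \<noteq> 1" using k False by auto
  \<comment> \<open>Minimality of \<open>k\<close> yields \<open>u (k - 1) < t\<close> only if
    \<open>k - 1\<close> is itself an admissible index; hence the first edge was treated
    apart.\<close>
  then have "k - 1 < k" "1 \<le> k - 1" using k by auto
  then have "\<not> t \<le> u (k - 1)" using not_less_Least[of "k - 1" "\<lambda>i. 1 \<le> i \<and> t \<le> u i"]
    unfolding k_def[symmetric] by auto
  ultimately show ?thesis using that[of k] k by auto
qed

text \<open>The slope inequality for convex functions at three consecutive nodes compares
  neighbouring edges; induction chains these comparisons.\<close>

lemma slopes_mono_if_convex:
  assumes "convex_on {u 0..u n} (polygonal u v)"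
  shows "mono_on {1..n} s"
proof -
  have le_Suc: "s i \<le> s (Suc i)" if i: "1 \<le> i" "Suc i \<le> n" for i
  proof -
    have l: "u (i - 1) < u i" "u i < u (Suc i)" using node_less i by auto
    have in_range: "u j \<in> {u 0..u n}" if "j \<le> n" for j using node_le that by auto
    have vert: "polygonal u v (u j) = v j" if "j \<le> n" for j
      using polygonal_vertex[OF nodes n_pos that] .
    have "(v (i - 1) - v i) / (u (i - 1) - u i) \<le> (v i - v (Suc i)) / (u i - u (Suc i))"
    proof -
      have "i - 1 \<le> n" "i \<le> n" using i by auto
      \<comment> \<open>Both edge slopes are compared with the slope of the chord spanning the two
        edges, and transitivity removes that chord.\<close>
      note sl = convex_on_slope_le[OF assms in_range[OF this(1)] in_range[OF i(2)] l]
      from order.trans[OF sl] show ?thesis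
        unfolding vert[OF \<open>i - 1 \<le> n\<close>] vert[OF \<open>i \<le> n\<close>] vert[OF i(2)] .
    qed
    moreover have "v (i - 1) - v i = s i * (u (i - 1) - u i)"
      using edge[of i] i by (simp add: algebra_simps)
    moreover have "v i - v (Suc i) = s (Suc i) * (u i - u (Suc i))"
      using edge[of "Suc i"] i by (simp add: algebra_simps)
    ultimately show ?thesis using l by simp
  qed
  have "s i \<le> s j" if "1 \<le> i" "i \<le> j" "j \<le> n" for i j
    using that(2,3)
  proof (induction j rule: dec_induct)
    case (step j)
    then show ?case using le_Suc[of j] \<open>1 \<le> i\<close> by simp
  qed simp
  then show ?thesis by (auto intro!: mono_onI)
qed

section \<open>Polygons with nondecreasing slopes: convexity and minimizers\<close>

context
  assumes slopes: "mono_on {1..n} s"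
begin

lemma slope_le: "1 \<le> i \<Longrightarrow> i \<le> j \<Longrightarrow> j \<le> n \<Longrightarrow> s i \<le> s j"
  using mono_onD[OF slopes, of i j] by auto

text \<open>Walk from vertex \<open>k\<close> one edge at a time. To the right every edge is at
  least as steep as edge \<open>k\<close>, to the left at most as steep, so each step keeps the
  vertices above the line.\<close>

lemma support_line_vertex:
  assumes k: "k \<in> {1..n}" and j: "j \<le> n"
  shows "v k + s k * (u j - u k) \<le> v j"
proof (cases "k \<le> j")
  case True
  then show ?thesis using j
  proof (induction j rule: dec_induct)
    case (step j)
    have "v (Suc j) = v j + s (Suc j) * (u (Suc j) - u j)" using edge[of "Suc j"] step by auto
    moreover have "s k * (u (Suc j) - u j) \<le> s (Suc j) * (u (Suc j) - u j)"
      using slope_le[of k "Suc j"] node_less[of j "Suc j"] k step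
      by (intro mult_right_mono) auto
    ultimately show ?case using step by (simp add: algebra_simps)
  qed simp
next
  case False
  then have "j \<le> k" by simp
  then show ?thesis
  proof (induction j rule: inc_induct)
    case (step j)
    have "v (Suc j) = v j + s (Suc j) * (u (Suc j) - u j)" using edge[of "Suc j"] step k by auto
    moreover have "s (Suc j) * (u (Suc j) - u j) \<le> s k * (u (Suc j) - u j)"
      using slope_le[of "Suc j" k] node_less[of j "Suc j"] k step
      by (intro mult_right_mono) auto
    ultimately show ?case using step by (simp add: algebra_simps)
  qed simp
qed

text \<open>Within one edge the polygon and the line are both affine, so the inequality at the two
  end vertices passes to their convex combinations; \<open>w\<close> is the coordinate of
  \<open>t\<close> along its edge.\<close>

lemma support_line:
  assumes k: "k \<in> {1..n}" and t: "t \<in> {u 0..u n}"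
  shows "v k + s k * (t - u k) \<le> polygonal u v t"
proof -
  obtain i where i: "i \<in> {1..n}" "t \<in> {u (i - 1)..u i}" using edge_cover[OF t] .
  define d where "d = u i - u (i - 1)"
  define w where "w = (t - u (i - 1)) / d"
  have d: "d > 0" using node_less[of "i - 1" i] i by (auto simp: d_def)
  have l: "0 \<le> w" "w \<le> 1" "t = u (i - 1) + w * d"
    using d i by (auto simp: w_def field_simps d_def)
  have "v k + s k * (t - u k) =
      (1 - w) * (v k + s k * (u (i - 1) - u k)) + w * (v k + s k * (u i - u k))"
    unfolding l(3) d_def by algebra
  also have "\<dots> \<le> (1 - w) * v (i - 1) + w * v i"
    using support_line_vertex[OF k, of "i - 1"] support_line_vertex[OF k, of i] i l
    by (intro add_mono mult_left_mono) auto
  also have "\<dots> = v (i - 1) + s i * (w * d)"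
    unfolding edge[OF i(1)] d_def by algebra
  also have "\<dots> = polygonal u v t"
    using polygonal_on_edge[OF i] l(3) by simp
  finally show ?thesis .
qed

text \<open>The line through the edge containing the intermediate point \<open>t\<close> meets the
  polygon at \<open>t\<close> and lies below it at \<open>a\<close> and \<open>b\<close>. Affinity
  of the line then gives the convexity inequality.\<close>

lemma convex_if_slopes_mono: "convex_on {u 0..u n} (polygonal u v)"
proof (rule convex_onI)
  fix \<mu> a b :: real
  assume mu: "0 < \<mu>" "\<mu> < 1" and ab: "a \<in> {u 0..u n}" "b \<in> {u 0..u n}"
  define t where "t = (1 - \<mu>) *\<^sub>R a + \<mu> *\<^sub>R b"
  have "t \<in> {u 0..u n}"
    using convexD_alt[OF convex_real_interval(5) ab, of \<mu>] mu by (simp add: t_def)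
  then obtain i where i: "i \<in> {1..n}" "t \<in> {u (i - 1)..u i}" using edge_cover by blast
  have "polygonal u v t = v i + s i * (t - u i)"
    using polygonal_on_edge[OF i] edge[OF i(1)] by (simp add: algebra_simps)
  also have "\<dots> = (1 - \<mu>) * (v i + s i * (a - u i)) + \<mu> * (v i + s i * (b - u i))"
    by (simp add: t_def) algebra
  also have "\<dots> \<le> (1 - \<mu>) * polygonal u v a + \<mu> * polygonal u v b"
    using support_line[OF i(1) ab(1)] support_line[OF i(1) ab(2)] mu
    by (intro add_mono mult_left_mono) auto
  finally show "polygonal u v ((1 - \<mu>) *\<^sub>R a + \<mu> *\<^sub>R b)
      \<le> (1 - \<mu>) * polygonal u v a + \<mu> * polygonal u v b" by (simp add: t_def)
qed simp

text \<open>According to the sign of \<open>s b\<close>, the line through the edge ending at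
  \<open>b\<close> has height at least \<open>v b\<close> all the way to the left or all the way to
  the right, and the vertices lie above it.\<close>

lemma vertex_le_max:
  assumes "a < b" "b < c" "c \<le> n"
  shows "v b \<le> max (v a) (v c)"
proof (cases "s b \<le> 0")
  case True
  then have "s b * (u a - u b) \<ge> 0"
    using node_less[of a b] assms by (intro mult_nonpos_nonpos) auto
  then show ?thesis using support_line_vertex[of b a] assms by auto
next
  case False
  then have "s b * (u c - u b) \<ge> 0"
    using node_less[of b c] assms by auto
  then show ?thesis using support_line_vertex[of b c] assms by auto
qed

text \<open>Since \<open>v b\<close> is at most the larger of two minimal values, it is minimal too.
  The window \<open>{lo..hi}\<close> is kept free so that one argument serves both the proper cuts
  and all vertices.\<close>

lemma argmin_between:
  assumes "is_arg_min v (\<lambda>i. i \<in> {lo..hi}) a" "is_arg_min v (\<lambda>i. i \<in> {lo..hi}) c"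
    and "hi \<le> n" "a \<le> b" "b \<le> c"
  shows "is_arg_min v (\<lambda>i. i \<in> {lo..hi}) b"
proof (cases "a = b \<or> b = c")
  case False
  have range: "lo \<le> a" "c \<le> hi" using assms(1,2) by (simp_all add: is_arg_min_def)
  have "v b \<le> v j" if "j \<in> {lo..hi}" for j
  proof -
    have "v a \<le> v j" "v c \<le> v j" using assms(1,2) that by (simp_all add: is_arg_min_linorder)
    then show ?thesis using vertex_le_max[of a b c] False assms(3-5) range by linarith
  qed
  then show ?thesis using range assms(4,5) by (simp add: is_arg_min_linorder)
qed (use assms(1,2) in blast)

lemma consecutive_block_argmin:
  assumes "lo \<le> hi" "hi \<le> n"
  shows "consecutive_block {i. is_arg_min v (\<lambda>i. i \<in> {lo..hi}) i}" (is "consecutive_block ?S")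
proof (rule consecutive_blockI)
  have "?S \<subseteq> {lo..hi}" unfolding is_arg_min_def by blast
  then show "finite ?S" by (rule finite_subset) (rule finite_atLeastAtMost)
  have "\<exists>i. is_arg_min v (\<lambda>i. i \<in> {lo..hi}) i"
    by (rule ex_is_arg_min_if_finite) (use assms(1) in simp_all)
  then show "?S \<noteq> {}" by blast
  show "b \<in> ?S" if "a \<in> ?S" "c \<in> ?S" "a < b" "b < c" for a b c
    using argmin_between[OF that(1,2)[THEN CollectD] assms(2), of b] that(3,4) by (simp only: mem_Collect_eq less_imp_le)
qed

text \<open>Both ends of edge \<open>k\<close> lie between the minimizers \<open>a\<close> and
  \<open>c\<close>, so they are minimizers themselves and have equal height.\<close>

lemma argmin_edge_flat:
  assumes "is_arg_min v (\<lambda>i. i \<in> {0..n}) a" "is_arg_min v (\<lambda>i. i \<in> {0..n}) c"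
    and "a < k" "k \<le> c"
  shows "s k = 0"
proof -
  have "c \<le> n" using assms(2) by (simp add: is_arg_min_def)
  have "is_arg_min v (\<lambda>i. i \<in> {0..n}) (k - 1)"
    by (rule argmin_between[OF assms(1,2)]) (use assms(3,4) in simp_all)
  moreover have "is_arg_min v (\<lambda>i. i \<in> {0..n}) k"
    by (rule argmin_between[OF assms(1,2)]) (use assms(3,4) in simp_all)
  ultimately have "v k = v (k - 1)"
    unfolding is_arg_min_linorder by (intro antisym) blast+
  then show ?thesis
    using edge[of k] node_less[of "k - 1" k] assms(3,4) \<open>c \<le> n\<close> by simp
qed

text \<open>Two minimizers \<open>a < c\<close> would make the edge ending at \<open>c\<close>
  flat.\<close>

lemma unique_argmin_if_no_flat_edge:
  assumes "\<And>i. i \<in> {1..n} \<Longrightarrow> s i \<noteq> 0"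
  shows "\<exists>!i. is_arg_min v (\<lambda>i. i \<in> {0..n}) i"
proof -
  have "\<exists>i. is_arg_min v (\<lambda>i. i \<in> {0..n}) i"
    using ex_is_arg_min_if_finite[of "{0..n}" v] by simp
  moreover have False
    if "is_arg_min v (\<lambda>i. i \<in> {0..n}) a" "is_arg_min v (\<lambda>i. i \<in> {0..n}) c" "a < c" for a c
    using argmin_edge_flat[OF that(1,2), of c] assms[of c] that(2,3) by (simp add: is_arg_min_def)
  ultimately show ?thesis by (metis linorder_neqE_nat)
qed

text \<open>The line through a flat edge is horizontal and supports the polygon, so both ends of the
  edge are global minimizers. A further minimizer would force a second flat edge: edge
  \<open>i - 1\<close> if it lies to the left, the edge ending at it if it lies to the
  right.\<close>

lemma argmin_flat_edge:
  assumes i: "i \<in> {1..n}" "s i = 0" and only: "\<And>j. \<lbrakk>j \<in> {1..n}; s j = 0\<rbrakk> \<Longrightarrow> j = i"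
  shows "{j. is_arg_min v (\<lambda>i. i \<in> {0..n}) j} = {i - 1, i}"
proof -
  have "v i \<le> v j" if "j \<le> n" for j using support_line_vertex[OF i(1) that] i by simp
  moreover have "v (i - 1) = v i" using edge i by simp
  ultimately have mins: "is_arg_min v (\<lambda>i. i \<in> {0..n}) i" "is_arg_min v (\<lambda>i. i \<in> {0..n}) (i - 1)"
    using i by (auto simp: is_arg_min_linorder)
  have "j = i - 1 \<or> j = i" if j: "is_arg_min v (\<lambda>i. i \<in> {0..n}) j" for j
  proof (rule ccontr)
    assume ne: "\<not> (j = i - 1 \<or> j = i)"
    have "j \<le> n" using j by (simp add: is_arg_min_def)
    show False
    proof (cases "j < i")
      case True
      then have "j < i - 1" "i - 1 \<in> {1..n}" using ne i by auto
      then show ?thesis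
        using argmin_edge_flat[OF j mins(2), of "i - 1"] only[of "i - 1"] by auto
    next
      case False
      then show ?thesis
        using argmin_edge_flat[OF mins(1) j, of j] only[of j] ne i \<open>j \<le> n\<close> by auto
    qed
  qed
  then show ?thesis using mins by auto
qed

end

end

section \<open>The optimal risk and its change across one atom\<close>

lemma L_coef_sq:
  assumes "\<And>j. j \<in> {1..i} \<Longrightarrow> p j > 0" "1 \<le> i"
  shows "weighted_sse p x {1..i} = weighted_sse p x {1..i - 1} + p i * (L_coef x p i)\<^sup>2"
proof -
  have ins: "{1..i} = insert i {1..i - 1}" using assms(2) by auto
  have "{1..i - 1} = {1..<i}" using assms(2) by auto
  then have C: "C_down x p i = (\<Sum>j=1..i - 1. p j * (x i - x j))" by (simp add: C_down_def)
  have pos: "(\<Sum>j=1..k. p j) \<ge> 0" if "k \<le> i" for k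
    using assms(1) that by (intro sum_nonneg less_imp_le) auto
  have "weighted_sse p x {1..i} = weighted_sse p x {1..i - 1} +
    p i * ((\<Sum>j=1..i - 1. p j * (x i - x j))\<^sup>2 / ((\<Sum>j=1..i - 1. p j) * (\<Sum>j=1..i. p j)))"
    unfolding ins using assms by (intro weighted_sse_insert) auto
  \<comment> \<open>For \<open>i = 1\<close> the left side is 0/0 = 0, the prescribed value of L_1;
    otherwise nonnegativity of the masses lets squaring undo the root.\<close>
  also have "(\<Sum>j=1..i - 1. p j * (x i - x j))\<^sup>2 / ((\<Sum>j=1..i - 1. p j) * (\<Sum>j=1..i. p j)) =
      (L_coef x p i)\<^sup>2"
    using pos[of i] pos[of "i - 1"]
    by (auto simp: L_coef_def C P_cum_def power_divide)
  finally show ?thesis by simp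
qed

lemma R_coef_sq:
  assumes "\<And>j. j \<in> {i..n} \<Longrightarrow> p j > 0" "i \<le> n"
  shows "weighted_sse p x {i..n} = weighted_sse p x {i + 1..n} + p i * (R_coef n x p i)\<^sup>2"
proof -
  have ins: "{i..n} = insert i {i + 1..n}" using assms(2) by auto
  have pos: "(\<Sum>j=k..n. p j) \<ge> 0" if "i \<le> k" for k
    using assms(1) that by (intro sum_nonneg less_imp_le) auto
  have "weighted_sse p x {i..n} = weighted_sse p x {i + 1..n} +
    p i * ((\<Sum>j=i + 1..n. p j * (x i - x j))\<^sup>2 / ((\<Sum>j=i + 1..n. p j) * (\<Sum>j=i..n. p j)))"
    unfolding ins using assms by (intro weighted_sse_insert) auto
  \<comment> \<open>\<open>A_up\<close> takes its differences in the opposite direction; the sign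
    disappears on squaring.\<close>
  also have "(\<Sum>j=i + 1..n. p j * (x i - x j)) = - A_up n x p i"
    by (simp add: A_up_def algebra_simps flip: sum_negf)
  also have "(- A_up n x p i)\<^sup>2 / ((\<Sum>j=i + 1..n. p j) * (\<Sum>j=i..n. p j)) = (R_coef n x p i)\<^sup>2"
    using pos[of i] pos[of "i + 1"]
    by (auto simp: R_coef_def A_up_def T_tail_def power_divide mult.commute)
  finally show ?thesis by simp
qed

text \<open>The loss separates into a function of \<open>a\<close> and one of \<open>b\<close>.
  Completing the square in each shows that the two block means attain the minimum, so
  \<open>LEAST\<close> is well determined.\<close>

lemma Least_cut_loss:
  assumes "\<And>j. j \<in> {1..n} \<Longrightarrow> p j > 0" "1 \<le> i" "i < n"
  shows "(LEAST v. \<exists>a b. v = cut_loss n x p i a b) =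
    weighted_sse p x {1..i} + weighted_sse p x {i + 1..n}"
proof -
  have pos: "(\<Sum>j=1..i. p j) > 0" "(\<Sum>j=i + 1..n. p j) > 0"
    by (rule sum_pos; use assms in auto)+
  define m where "m S = (\<Sum>j\<in>S. p j * x j) / (\<Sum>j\<in>S. p j)" for S
  have loss: "cut_loss n x p i a b = weighted_sse p x {1..i} + weighted_sse p x {i + 1..n}
     + (\<Sum>j=1..i. p j) * (a - m {1..i})\<^sup>2 + (\<Sum>j=i + 1..n. p j) * (b - m {i + 1..n})\<^sup>2" for a b
    using pos by (simp add: cut_loss_def weighted_sum_squares_eq m_def)
  show ?thesis
  proof (rule Least_equality)
    show "\<exists>a b. weighted_sse p x {1..i} + weighted_sse p x {i + 1..n} = cut_loss n x p i a b"
      by (rule exI[of _ "m {1..i}"], rule exI[of _ "m {i + 1..n}"]) (simp add: loss)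
    fix v assume "\<exists>a b. v = cut_loss n x p i a b"
    moreover have "0 \<le> (\<Sum>j=1..i. p j) * (a - m {1..i})\<^sup>2"
      "0 \<le> (\<Sum>j=i + 1..n. p j) * (b - m {i + 1..n})\<^sup>2" for a b using pos by simp_all
    ultimately show "weighted_sse p x {1..i} + weighted_sse p x {i + 1..n} \<le> v"
      by (smt (verit) loss)
  qed
qed

text \<open>Distinct atoms allow sums over values to be reindexed by \<open>I\<close>. Centring at
  the mean makes the extra square in \<open>weighted_sum_squares_eq\<close> vanish.\<close>

lemma (in prob_space) variance_finite_law:
  fixes X :: "'a \<Rightarrow> real"
  assumes X: "random_variable borel X" and I: "finite I" and x: "inj_on x I"
    and p: "\<And>i. i \<in> I \<Longrightarrow> p i = prob {\<omega> \<in> space M. X \<omega> = x i}" and one: "(\<Sum>i\<in>I. p i) = 1"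
  shows "variance X = weighted_sse p x I"
proof -
  have law: "expectation (\<lambda>\<omega>. f (X \<omega>)) = (\<Sum>i\<in>I. p i * f (x i))"
    if "f \<in> borel_measurable borel" for f
    using expectation_finite_law[OF X, of "x ` I" f] I one that
    by (simp add: sum.reindex[OF x] p)
  have "expectation X = (\<Sum>i\<in>I. p i * x i)" using law[of "\<lambda>y. y"] by simp
  moreover have "variance X = (\<Sum>i\<in>I. p i * (x i - expectation X)\<^sup>2)"
    using law[of "\<lambda>y. (y - expectation X)\<^sup>2"] by simp
  ultimately show ?thesis using one by (simp add: weighted_sum_squares_eq)
qed


section \<open>Slopes, convexity and minimizers of the risk polygon\<close>

theorem corollary2p2:
  fixes M :: "'a measure" and X :: "'a \<Rightarrow> real"
    and n :: nat and x p :: "nat \<Rightarrow> real"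
  assumes "prob_space M"
    and "X \<in> borel_measurable M"
    and "n \<ge> 2"
    and "strict_mono_on {1..n} x"
    and "\<forall>i\<in>{1..n}. p i = measure M {\<omega> \<in> space M. X \<omega> = x i}"
    and "\<forall>i\<in>{1..n}. p i > 0"
    and "(\<Sum>i=1..n. p i) = 1"
  shows "(\<forall>i\<in>{1..n}.
            (\<forall>s\<in>{P_cum p (i - 1)..P_cum p i}. \<forall>t\<in>{P_cum p (i - 1)..P_cum p i}. s \<noteq> t \<longrightarrow>
               (W_poly M X n x p t - W_poly M X n x p s) / (t - s)
                 = (W_risk M X n x p i - W_risk M X n x p (i - 1)) / p i)
            \<and> (W_risk M X n x p i - W_risk M X n x p (i - 1)) / p i
                 = (L_coef x p i)\<^sup>2 - (R_coef n x p i)\<^sup>2)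
       \<and> (convex_on {0..1} (W_poly M X n x p) \<longleftrightarrow> antimono_on {1..n} (D_seq n x p))
       \<and> (antimono_on {1..n} (D_seq n x p) \<longrightarrow>
            consecutive_block (minimizing_cuts M X n x p)
            \<and> consecutive_block (minimizing_vertices M X n x p))
       \<and> (strict_antimono_on {1..n} (D_seq n x p) \<longrightarrow>
            ((\<forall>i\<in>{1..n}. D_seq n x p i \<noteq> 0) \<longrightarrow> (\<exists>!i. i \<in> minimizing_vertices M X n x p))
            \<and> (\<forall>i\<in>{1..n}. D_seq n x p i = 0 \<longrightarrow>
                 minimizing_vertices M X n x p = {i - 1, i}
                 \<and> (\<forall>t\<in>{P_cum p (i - 1)..P_cum p i}. W_poly M X n x p t = W_risk M X n x p i)))"
proof -
  interpret prob_space M by fact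
  let ?W = "W_risk M X n x p" and ?u = "P_cum p"
  let ?s = "\<lambda>i. (L_coef x p i)\<^sup>2 - (R_coef n x p i)\<^sup>2"
  have pos: "p j > 0" if "j \<in> {1..n}" for j using assms(6) that by blast
  have "variance X = weighted_sse p x {1..n}"
    by (rule variance_finite_law)
      (use assms strict_mono_on_imp_inj_on[OF assms(4)] in auto)
  \<comment> \<open>At \<open>i = 0\<close> and \<open>i = n\<close> one block is empty and
    contributes 0, so the variance convention at the ends fits the same formula as the interior
    cuts.\<close>
  then have W: "?W i = weighted_sse p x {1..i} + weighted_sse p x {i + 1..n}" if "i \<le> n" for i
    using Least_cut_loss[of n p i x] pos that
    by (auto simp: W_risk_def weighted_sse_def)
  have step: "?W i - ?W (i - 1) = p i * ?s i" if i: "i \<in> {1..n}" for i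
  proof -
    have "i - 1 + 1 = i" "i \<le> n" "i - 1 \<le> n" using i by auto
    then show ?thesis
      using W[of i] W[of "i - 1"] L_coef_sq[of i p x] R_coef_sq[of i n p x] pos i
      by (simp add: right_diff_distrib)
  qed
  have du: "?u i - ?u (i - 1) = p i" if i: "i \<in> {1..n}" for i
    using i by (cases i) (auto simp: P_cum_def)
  interpret polygon n ?u ?W ?s
  proof
    show "strict_mono_on {0..n} ?u"
    proof (rule strict_mono_onI)
      fix a b assume ab: "a \<in> {0..n}" "b \<in> {0..n}" "a < b"
      then show "?u a < ?u b" unfolding P_cum_def
        by (intro sum_strict_mono2[of _ _ b]) (use pos in \<open>auto intro: less_imp_le\<close>)
    qed
    show "1 \<le> n" using assms(3) by simp
    show "?W i = ?W (i - 1) + ?s i * (?u i - ?u (i - 1))" if "i \<in> {1..n}" for i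
      using step[OF that] du[OF that] by (simp add: mult.commute)
  qed
  have D: "D_seq n x p i = - ?s i" for i by (simp add: D_seq_def)
  have zero: "D_seq n x p i = 0 \<longleftrightarrow> ?s i = 0" for i by (auto simp: D)
  have anti: "antimono_on {1..n} (D_seq n x p) \<longleftrightarrow> mono_on {1..n} ?s"
  proof -
    have "D_seq n x p j \<le> D_seq n x p i \<longleftrightarrow> ?s i \<le> ?s j" for i j by (auto simp: D)
    then show ?thesis by (simp add: monotone_on_def)
  qed
  have slope: "(?W i - ?W (i - 1)) / p i = ?s i" if "i \<in> {1..n}" for i
    using step[OF that] pos[OF that] by simp
  \<comment> \<open>This identifies the domain \<open>{?u 0..?u n}\<close> of the polygon with the
    unit interval.\<close>
  have ends: "?u 0 = 0" "?u n = 1" using assms(7) by (auto simp: P_cum_def)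
  have chord: "(W_poly M X n x p t - W_poly M X n x p s) / (t - s) = ?s i"
    if i: "i \<in> {1..n}" and "s \<in> {?u (i - 1)..?u i}" "t \<in> {?u (i - 1)..?u i}" "s \<noteq> t" for i s t
  proof -
    have "W_poly M X n x p t - W_poly M X n x p s = ?s i * (t - s)"
      unfolding W_poly_def polygonal_on_edge[OF i that(2)] polygonal_on_edge[OF i that(3)] by algebra
    then show ?thesis using that by simp
  qed
  have cuts: "minimizing_cuts M X n x p = {i. is_arg_min ?W (\<lambda>i. i \<in> {1..n - 1}) i}"
  proof -
    have "{1..<n} = {1..n - 1}" using assms(3) by auto
    then show ?thesis by (simp only: minimizing_cuts_def)
  qed
  have blocks: "consecutive_block (minimizing_cuts M X n x p)
      \<and> consecutive_block (minimizing_vertices M X n x p)" if "mono_on {1..n} ?s"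
    unfolding cuts minimizing_vertices_def
    by (intro conjI consecutive_block_argmin[OF that]) (use assms(3) in simp_all)
  have strict: "((\<forall>i\<in>{1..n}. D_seq n x p i \<noteq> 0) \<longrightarrow> (\<exists>!i. i \<in> minimizing_vertices M X n x p))
      \<and> (\<forall>i\<in>{1..n}. D_seq n x p i = 0 \<longrightarrow> minimizing_vertices M X n x p = {i - 1, i}
           \<and> (\<forall>t\<in>{?u (i - 1)..?u i}. W_poly M X n x p t = ?W i))"
    if sa: "strict_antimono_on {1..n} (D_seq n x p)"
  proof (intro conjI impI ballI)
    have "D_seq n x p j \<le> D_seq n x p i" if "i \<in> {1..n}" "j \<in> {1..n}" "i \<le> j" for i j
      using sa that unfolding monotone_on_def by (cases "i = j") (auto intro: less_imp_le)
    then have mono: "mono_on {1..n} ?s"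
      unfolding anti[symmetric] by (auto simp: monotone_on_def)
    show "\<exists>!i. i \<in> minimizing_vertices M X n x p" if "\<forall>i\<in>{1..n}. D_seq n x p i \<noteq> 0"
      unfolding minimizing_vertices_def mem_Collect_eq
      by (rule unique_argmin_if_no_flat_edge[OF mono]) (use that in \<open>auto simp: zero\<close>)
    fix i assume i: "i \<in> {1..n}" and Di: "D_seq n x p i = 0"
    \<comment> \<open>A strictly decreasing sequence is injective, so it has at most one zero and
      the polygon at most one flat edge.\<close>
    have "j = i" if "j \<in> {1..n}" "?s j = 0" for j
    proof (rule ccontr)
      assume "j \<noteq> i"
      then have "D_seq n x p j \<noteq> D_seq n x p i"
        using sa that(1) i unfolding monotone_on_def by (metis linorder_neqE_nat order_less_irrefl)
      then show False using that(2) Di zero by simp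
    qed
    then show "minimizing_vertices M X n x p = {i - 1, i}"
      unfolding minimizing_vertices_def
      by (intro argmin_flat_edge[OF mono i]) (use Di in \<open>auto simp: zero\<close>)
    fix t assume t: "t \<in> {?u (i - 1)..?u i}"
    show "W_poly M X n x p t = ?W i"
      using polygonal_on_edge[OF i t] edge[OF i] Di unfolding W_poly_def zero by simp
  qed
  have convex: "convex_on {0..1} (W_poly M X n x p) \<longleftrightarrow> antimono_on {1..n} (D_seq n x p)"
    using slopes_mono_if_convex convex_if_slopes_mono unfolding anti W_poly_def ends by blast
  show ?thesis
    using slope chord convex blocks strict unfolding anti by simp
qed

end
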